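(* Let $\theta=\frac12(\sqrt5-1)$ and let $(s_i)_{i\ge0}$ be given by $s_i=\lfloor (i+2)\theta\rfloor-\lfloor (i+1)\theta\rfloor$. Let $n\ge2$ be an integer and put $r=L_{2n}$, $a=F_{2n-1}-1$, $b=L_{2n}-1$. Then $s_{rk+a}=s_{rk+b}$ for all $0\le k\le F_{4n+1}-F_{2n+1}-2$, while for $k=F_{4n+1}-F_{2n+1}-1$ we have $s_{rk+a}=0$ and $s_{rk+b}=1$.
   Context: Fibonacci numbers: $F_0=0$, $F_1=1$, $F_n=F_{n-1}+F_{n-2}$. Lucas numbers: $L_0=2$, $L_1=1$, $L_n=L_{n-1}+L_{n-2}$. *)

theory Defs
  imports Complex_Main "HOL-Number_Theory.Fib"
begin

fun lucas :: "nat \<Rightarrow> nat" where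
  "lucas 0 = 2"
| "lucas (Suc 0) = 1"
| "lucas (Suc (Suc n)) = lucas (Suc n) + lucas n"

definition theta :: real where
  "theta = (sqrt 5 - 1) / 2"

definition s :: "nat \<Rightarrow> int" where
  "s i = \<lfloor>real (i + 2) * theta\<rfloor> - \<lfloor>real (i + 1) * theta\<rfloor>"

text \<open>The next three facts say that none of the natural-number differences
  \<open>fib (2 * n - 1) - 1\<close>, \<open>lucas (2 * n) - 1\<close> and \<open>fib (4 * n + 1) - fib (2 * n + 1) - 2\<close>
  is truncated when \<open>n \<ge> 2\<close>.\<close>

lemma fib_odd_ge_1: "n \<ge> 2 \<Longrightarrow> fib (2 * n - 1) \<ge> 1"
  using fib_neq_0_nat[of "2 * n - 1"] by linarith

lemma lucas_ge_1: "lucas n \<ge> 1"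
  by (induction n rule: lucas.induct) auto

lemma fib_diff_ge_2:
  assumes "n \<ge> 2"
  shows "fib (4 * n + 1) \<ge> fib (2 * n + 1) + 2"
proof -
  have "fib (2 * n + 1) \<le> fib (4 * n - 1)"
    using assms by (intro fib_mono) auto
  moreover have "fib 3 \<le> fib (4 * n)"
    using assms by (intro fib_mono) auto
  moreover have "fib 3 = 2"
    by (simp add: numeral_3_eq_3)
  moreover have "fib (4 * n + 1) = fib (4 * n) + fib (4 * n - 1)"
    using assms by (cases "4 * n") auto
  ultimately show ?thesis
    by linarith
qed

end

theory Submission
  imports Defs
begin

text \<open>
  Put \<open>m = k + 1\<close> and \<open>\<phi> = \<theta> + 1\<close>. The two positions differ by \<open>F\<^bsub>2n+1\<^esub>\<close>, and \<open>F\<^bsub>2n+1\<^esub> \<phi>\<close>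
  exceeds an integer by \<open>\<theta>\<^bsup>2n+1\<^esup>\<close>. So the two values of \<open>s\<close> can differ only if \<open>(m L\<^bsub>2n\<^esub> + i) \<phi>\<close>,
  with \<open>i = 0\<close> or \<open>i = 1\<close>, exceeds an integer by less than \<open>\<theta>\<^bsup>2n+1\<^esup>\<close>. Writing that integer as
  \<open>m L\<^bsub>2n+1\<^esub> + q\<close> and multiplying by the unit \<open>\<phi>\<^bsup>2n\<^esup>\<close> turns this condition into
  \<open>0 \<le> j \<surd>5 - (q + i \<theta>) \<theta>\<^bsup>2n\<^esup> < \<theta>\<close> with \<open>j = m + i F\<^bsub>2n+1\<^esub> - q F\<^bsub>2n\<^esub>\<close>. It forces \<open>j \<ge> 1\<close>,
  then \<open>q \<ge> L\<^bsub>2n+1\<^esub>\<close>, and hence \<open>m + i F\<^bsub>2n+1\<^esub> \<ge> 1 + F\<^bsub>2n\<^esub> L\<^bsub>2n+1\<^esub> = F\<^bsub>4n+1\<^esub>\<close>. For \<open>i = 1\<close>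
  this bound is attained.
\<close>

definition phi :: real where
  "phi = (1 + sqrt 5) / 2"

lemma phi_eq_theta_plus_1: "phi = theta + 1"
  by (simp add: phi_def theta_def field_simps)

lemma phi_times_theta: "phi * theta = 1"
  by (simp add: phi_def theta_def field_simps)

lemma sqrt_5_eq_phi_plus_theta: "sqrt 5 = phi + theta"
  by (simp add: phi_def theta_def field_simps)

lemma theta_pos: "0 < theta" and theta_less_1: "theta < 1"
proof -
  have "1 < sqrt 5" "sqrt 5 < 3"
    by (rule real_less_rsqrt real_less_lsqrt; simp)+
  then show "0 < theta" "theta < 1"
    by (simp_all add: theta_def)
qed

lemma phi_pos: "0 < phi"
  using theta_pos by (simp add: phi_eq_theta_plus_1)

lemma phi_power_times_theta_power: "phi ^ n * theta ^ n = 1"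
  by (simp add: phi_times_theta flip: power_mult_distrib)

lemma sqrt_5_times_fib: "sqrt 5 * fib n = phi ^ n - (- theta) ^ n"
proof -
  have "(1 - sqrt 5) / 2 = - theta"
    by (simp add: theta_def field_simps)
  then show ?thesis
    using fib_closed_form[of n] by (simp add: phi_def)
qed

lemma lucas_eq_powers: "lucas n = phi ^ n + (- theta) ^ n"
proof (induction n rule: lucas.induct)
  case (3 n)
  have "x ^ Suc (Suc n) = x ^ Suc n + x ^ n" if "x * x = x + 1" for x :: real
    by (simp add: that distrib_right flip: mult.assoc)
  moreover have "phi * phi = phi + 1" "- theta * - theta = - theta + 1"
    using phi_times_theta by (simp_all add: phi_eq_theta_plus_1 algebra_simps)
  ultimately have "phi ^ Suc (Suc n) = phi ^ Suc n + phi ^ n"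
    "(- theta) ^ Suc (Suc n) = (- theta) ^ Suc n + (- theta) ^ n"
    by blast+
  with "3.IH" show ?case
    by (simp only: lucas.simps of_nat_add)
qed (simp_all add: phi_eq_theta_plus_1)

lemma fib_times_phi: "fib n * phi = fib (Suc n) - (- theta) ^ n"
proof -
  have "sqrt 5 * (fib n * phi) = (phi ^ n - (- theta) ^ n) * phi"
    by (simp only: sqrt_5_times_fib flip: mult.assoc)
  also have "\<dots> = phi ^ Suc n - (- theta) ^ Suc n - sqrt 5 * (- theta) ^ n"
    by (simp add: sqrt_5_eq_phi_plus_theta algebra_simps)
  also have "\<dots> = sqrt 5 * (fib (Suc n) - (- theta) ^ n)"
    by (simp only: sqrt_5_times_fib right_diff_distrib)
  finally show ?thesis
    by simp
qed

lemma lucas_times_phi: "lucas n * phi = lucas (Suc n) + sqrt 5 * (- theta) ^ n"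
  by (simp only: lucas_eq_powers sqrt_5_eq_phi_plus_theta) (simp add: algebra_simps)

lemma lucas_Suc_eq_fib: "lucas (Suc n) = fib n + fib (Suc (Suc n))"
  by (induction n rule: fib.induct) auto

lemma fib_times_lucas_Suc:
  "int (fib n * lucas (Suc n)) = int (fib (Suc (2 * n))) - (- 1) ^ n"
proof -
  have "fib (Suc (2 * n)) = (fib (Suc n))\<^sup>2 + (fib n)\<^sup>2"
    using fib_add[of n n] by (simp add: power2_eq_square mult_2)
  then show ?thesis
    using fib_Cassini_int[of n] by (simp add: lucas_Suc_eq_fib power2_eq_square algebra_simps)
qed

lemma s_eq_floor_phi: "s i = \<lfloor>real (i + 2) * phi\<rfloor> - \<lfloor>real (i + 1) * phi\<rfloor> - 1"
proof -
  have floor_phi: "\<lfloor>real j * phi\<rfloor> = \<lfloor>real j * theta\<rfloor> + int j" for j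
    using floor_add_int[of "real j * theta" "int j"]
    by (simp add: phi_eq_theta_plus_1 algebra_simps)
  show ?thesis
    using floor_phi[of "i + 2"] floor_phi[of "i + 1"] unfolding s_def by linarith
qed

lemma s_nonneg: "0 \<le> s i" and s_le_1: "s i \<le> 1"
proof -
  have "real (i + 2) * theta = real (i + 1) * theta + theta"
    by (simp add: algebra_simps)
  then show "0 \<le> s i" "s i \<le> 1"
    using theta_pos theta_less_1 unfolding s_def by linarith+
qed

lemma floor_minus_floor_diff:
  fixes x e :: "'a :: floor_ceiling"
  assumes "0 \<le> e" "e \<le> 1"
  shows "\<lfloor>x\<rfloor> - \<lfloor>x - e\<rfloor> = of_bool (frac x < e)"
proof (cases "frac x < e")
  case True
  then have "\<lfloor>x - e\<rfloor> = \<lfloor>x\<rfloor> - 1"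
    using assms of_int_floor_le[of x] unfolding frac_def floor_eq_iff of_int_diff of_int_1
    by (intro conjI) linarith+
  with True show ?thesis
    by simp
next
  case False
  then have "\<lfloor>x - e\<rfloor> = \<lfloor>x\<rfloor>"
    using assms frac_lt_1[of x] unfolding frac_def floor_eq_iff by (intro conjI) linarith+
  with False show ?thesis
    by simp
qed

definition just_above_int :: "nat \<Rightarrow> nat \<Rightarrow> bool" where
  "just_above_int n i \<longleftrightarrow> frac (real i * phi) < theta ^ Suc (2 * n)"

lemma floor_add_fib_times_phi:
  "\<lfloor>real (i + fib (Suc (2 * n))) * phi\<rfloor> - \<lfloor>real i * phi\<rfloor> =
    int (fib (2 * n + 2)) + of_bool (just_above_int n (i + fib (Suc (2 * n))))"
proof -
  let ?x = "real (i + fib (Suc (2 * n))) * phi" and ?e = "theta ^ Suc (2 * n)"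
  have "real i * phi = ?x - ?e - of_int (int (fib (2 * n + 2)))"
    using fib_times_phi[of "Suc (2 * n)"] by (simp add: algebra_simps)
  then have "\<lfloor>real i * phi\<rfloor> = \<lfloor>?x - ?e\<rfloor> - int (fib (2 * n + 2))"
    by (simp only: floor_diff_of_int)
  moreover have "\<lfloor>?x\<rfloor> - \<lfloor>?x - ?e\<rfloor> = of_bool (frac ?x < ?e)"
    using theta_pos theta_less_1 by (intro floor_minus_floor_diff power_le_one) simp_all
  ultimately show ?thesis
    unfolding just_above_int_def by linarith
qed

lemma s_add_fib_diff:
  "s (i + fib (Suc (2 * n))) - s i =
    of_bool (just_above_int n (i + fib (Suc (2 * n)) + 2)) -
    of_bool (just_above_int n (i + fib (Suc (2 * n)) + 1))"
  using floor_add_fib_times_phi[of "i + 2" n] floor_add_fib_times_phi[of "i + 1" n]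
  unfolding s_eq_floor_phi add.assoc add.commute[of "fib (Suc (2 * n))"] by linarith

lemma s_lucas_progression_diff:
  assumes "1 \<le> n"
  shows "s (lucas (2 * n) * k + (lucas (2 * n) - 1))
      - s (lucas (2 * n) * k + (fib (2 * n - 1) - 1)) =
    of_bool (just_above_int n ((k + 1) * lucas (2 * n) + 1)) -
    of_bool (just_above_int n ((k + 1) * lucas (2 * n)))"
proof -
  let ?i = "lucas (2 * n) * k + (fib (2 * n - 1) - 1)"
  have "lucas (2 * n) = fib (2 * n - 1) + fib (Suc (2 * n))"
    using lucas_Suc_eq_fib[of "2 * n - 1"] assms by simp
  moreover have "1 \<le> fib (2 * n - 1)"
    using fib_neq_0_nat[of "2 * n - 1"] assms by linarith
  ultimately have "lucas (2 * n) * k + (lucas (2 * n) - 1) = ?i + fib (Suc (2 * n))"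
    "?i + fib (Suc (2 * n)) + 1 = (k + 1) * lucas (2 * n)"
    "?i + fib (Suc (2 * n)) + 2 = (k + 1) * lucas (2 * n) + 1"
    by (simp_all add: algebra_simps)
  then show ?thesis
    by (simp only: s_add_fib_diff)
qed

lemma lucas_multiple_plus_int_times_phi:
  fixes m i :: real
  shows "(m * lucas (2 * n) + i) * phi =
    m * lucas (Suc (2 * n)) + m * sqrt 5 * theta ^ (2 * n) + i * phi"
proof -
  have "(m * lucas (2 * n) + i) * phi = m * (lucas (2 * n) * phi) + i * phi"
    by (simp add: algebra_simps)
  also have "\<dots> = m * (lucas (Suc (2 * n)) + sqrt 5 * theta ^ (2 * n)) + i * phi"
    by (simp add: lucas_times_phi)
  finally show ?thesis
    by (simp add: algebra_simps)
qed

lemma lucas_multiple_minus_int_times_unit: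
  fixes m i q :: real
  shows "((m * lucas (2 * n) + i) * phi - (m * lucas (Suc (2 * n)) + q)) * phi ^ (2 * n) =
    (m + i * fib (Suc (2 * n)) - q * fib (2 * n)) * sqrt 5 - (q + i * theta) * theta ^ (2 * n)"
proof -
  have "((m * lucas (2 * n) + i) * phi - (m * lucas (Suc (2 * n)) + q)) * phi ^ (2 * n) =
      m * sqrt 5 * (phi ^ (2 * n) * theta ^ (2 * n)) + i * phi ^ Suc (2 * n) - q * phi ^ (2 * n)"
    unfolding lucas_multiple_plus_int_times_phi by (simp add: algebra_simps)
  also have "\<dots> = m * sqrt 5 + i * phi ^ Suc (2 * n) - q * phi ^ (2 * n)"
    by (simp only: phi_power_times_theta_power mult_1_right)
  also have "\<dots> = m * sqrt 5 + i * (sqrt 5 * fib (Suc (2 * n)) - theta ^ Suc (2 * n))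
      - q * (sqrt 5 * fib (2 * n) + theta ^ (2 * n))"
    by (simp add: sqrt_5_times_fib)
  finally show ?thesis
    by (simp add: algebra_simps)
qed

lemma lucas_multiple_quotient_pos:
  fixes m i q :: real
  assumes "1 \<le> m" "0 \<le> i"
    and close: "(m * lucas (2 * n) + i) * phi - (m * lucas (Suc (2 * n)) + q) < theta ^ Suc (2 * n)"
  shows "0 < q"
proof -
  have "(m * sqrt 5 - theta) * theta ^ (2 * n) + i * phi < q"
    using close unfolding lucas_multiple_plus_int_times_phi by (simp add: algebra_simps)
  moreover have "sqrt 5 \<le> m * sqrt 5"
    using mult_right_mono[OF \<open>1 \<le> m\<close>, of "sqrt 5"] by simp
  then have "0 < m * sqrt 5 - theta"
    using sqrt_5_eq_phi_plus_theta phi_pos by linarith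
  then have "0 < (m * sqrt 5 - theta) * theta ^ (2 * n)"
    using theta_pos by simp
  moreover have "0 \<le> i * phi"
    using \<open>0 \<le> i\<close> phi_pos by simp
  ultimately show ?thesis
    by linarith
qed

lemma times_phi_power_less_theta_iff: "x * phi ^ n < theta \<longleftrightarrow> x < theta ^ Suc n"
proof -
  have "theta = theta ^ Suc n * phi ^ n"
    using phi_power_times_theta_power[of n] by (simp add: mult.assoc mult.commute[of "phi ^ n"])
  then show ?thesis
    using phi_pos by (metis mult_less_cancel_right_pos zero_less_power)
qed

lemma
  fixes j :: int and t :: real
  assumes "0 < t" and nonneg: "0 \<le> j * sqrt 5 - t * theta ^ n"
    and close: "j * sqrt 5 - t * theta ^ n < theta"
  shows sqrt_5_coeff_ge_1_if_close: "1 \<le> j"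
    and phi_power_less_if_sqrt_5_multiple_close: "phi ^ Suc n < t"
proof -
  have "0 < t * theta ^ n"
    using \<open>0 < t\<close> theta_pos by simp
  then have "0 < j * sqrt 5"
    using nonneg by linarith
  then show "1 \<le> j"
    by (simp add: zero_less_mult_iff)
  then have "1 * sqrt 5 \<le> j * sqrt 5"
    by (intro mult_right_mono) simp_all
  then have "phi < t * theta ^ n"
    using close sqrt_5_eq_phi_plus_theta by linarith
  then have "phi * phi ^ n < t * theta ^ n * phi ^ n"
    using phi_pos by simp
  also have "\<dots> = t * (phi ^ n * theta ^ n)"
    by simp
  finally show "phi ^ Suc n < t"
    by (simp only: phi_power_times_theta_power power_Suc mult_1_right)
qed

lemma fib_le_if_just_above_int:
  assumes "1 \<le> m" "i \<le> 1" and above: "just_above_int n (m * lucas (2 * n) + i)"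
  shows "fib (Suc (4 * n)) \<le> m + i * fib (Suc (2 * n))"
proof -
  define x where "x = real (m * lucas (2 * n) + i) * phi"
  define q where "q = \<lfloor>x\<rfloor> - int (m * lucas (Suc (2 * n)))"
  define j where "j = int m + int i * int (fib (Suc (2 * n))) - q * int (fib (2 * n))"
  have frac_x: "frac x = (real m * lucas (2 * n) + i) * phi - (real m * lucas (Suc (2 * n)) + q)"
    by (simp add: x_def q_def frac_def)
  have frac_less: "frac x < theta ^ Suc (2 * n)"
    using above by (simp only: just_above_int_def x_def)
  have "0 < q"
    using lucas_multiple_quotient_pos[of m i n q] \<open>1 \<le> m\<close> frac_less frac_x by simp
  then have pos: "0 < q + i * theta"
    using theta_pos by (simp add: add_pos_nonneg)
  have scaled: "frac x * phi ^ (2 * n) = j * sqrt 5 - (q + i * theta) * theta ^ (2 * n)"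
    unfolding frac_x lucas_multiple_minus_int_times_unit by (simp add: j_def)
  have nonneg: "0 \<le> frac x * phi ^ (2 * n)"
    using phi_pos by simp
  have less: "frac x * phi ^ (2 * n) < theta"
    using frac_less by (simp only: times_phi_power_less_theta_iff)
  have "1 \<le> j"
    using sqrt_5_coeff_ge_1_if_close[OF pos] nonneg less unfolding scaled by blast
  have "phi ^ Suc (2 * n) < q + i * theta"
    using phi_power_less_if_sqrt_5_multiple_close[OF pos] nonneg less unfolding scaled by blast
  moreover have "lucas (Suc (2 * n)) < phi ^ Suc (2 * n)"
    using theta_pos by (simp add: lucas_eq_powers)
  moreover have "i * theta < 1"
    using \<open>i \<le> 1\<close> theta_less_1 by (cases i) simp_all
  ultimately have "int (lucas (Suc (2 * n))) \<le> q"
    by linarith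
  then have "int (lucas (Suc (2 * n))) * int (fib (2 * n)) \<le> q * int (fib (2 * n))"
    by (rule mult_right_mono) simp
  then have "int (fib (Suc (4 * n))) \<le> int (m + i * fib (Suc (2 * n)))"
    using \<open>1 \<le> j\<close> fib_times_lucas_Suc[of "2 * n"] by (simp add: j_def mult.commute)
  then show ?thesis
    by (simp only: of_nat_le_iff)
qed

lemma lucas_multiple_plus_1_times_phi:
  assumes "m + fib (Suc (2 * n)) = fib (Suc (4 * n))"
  shows "real (m * lucas (2 * n) + 1) * phi =
    real ((m + 1) * lucas (Suc (2 * n)))
      + theta ^ Suc (2 * n) * (1 - theta ^ (2 * n) * (1 - theta ^ (2 * n)))"
proof -
  let ?u = "phi ^ (2 * n)" and ?v = "theta ^ (2 * n)"
  have "real m = real (fib (Suc (4 * n))) - real (fib (Suc (2 * n)))"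
    using assms by linarith
  then have "sqrt 5 * m = sqrt 5 * fib (Suc (4 * n)) - sqrt 5 * fib (Suc (2 * n))"
    by (simp only: right_diff_distrib)
  also have "\<dots> = phi * ?u\<^sup>2 + theta * ?v\<^sup>2 - (phi * ?u + theta * ?v)"
    by (simp add: sqrt_5_times_fib flip: power_mult)
  finally have "m * sqrt 5 * ?v = (phi * ?u\<^sup>2 + theta * ?v\<^sup>2 - (phi * ?u + theta * ?v)) * ?v"
    by (simp only: mult.commute)
  also have "\<dots> = phi * ?u * (?u * ?v) - phi * (?u * ?v) + theta * ?v ^ 3 - theta * ?v\<^sup>2"
    by (simp add: algebra_simps power2_eq_square power3_eq_cube)
  also have "\<dots> = phi * ?u - phi + theta * ?v ^ 3 - theta * ?v\<^sup>2"
    by (simp only: phi_power_times_theta_power mult_1_right)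
  also have "\<dots> = lucas (Suc (2 * n)) - phi + theta * ?v * (1 - ?v * (1 - ?v))"
    by (simp add: lucas_eq_powers algebra_simps power2_eq_square power3_eq_cube)
  finally show ?thesis
    using lucas_multiple_plus_int_times_phi[of m n 1] by (simp add: algebra_simps)
qed

lemma just_above_int_lucas_multiple_plus_1:
  assumes "1 \<le> n" and m: "m + fib (Suc (2 * n)) = fib (Suc (4 * n))"
  shows "just_above_int n (m * lucas (2 * n) + 1)"
proof -
  let ?v = "theta ^ (2 * n)"
  let ?e = "theta ^ Suc (2 * n) * (1 - ?v * (1 - ?v))"
  have v: "0 < ?v" "?v < 1"
    using theta_pos theta_less_1 \<open>1 \<le> n\<close> by (simp_all add: power_less_one_iff)
  have nonneg: "0 \<le> ?e"
    using v theta_pos by (simp add: mult_le_one)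
  have "?e < theta ^ Suc (2 * n) * 1"
    using v theta_pos by (intro mult_strict_left_mono) simp_all
  then have less: "?e < theta ^ Suc (2 * n)"
    by (simp only: mult_1_right)
  also have "theta ^ Suc (2 * n) \<le> 1"
    using theta_pos theta_less_1 by (intro power_le_one) simp_all
  finally have "?e < 1" .
  then have "frac (real (m * lucas (2 * n) + 1) * phi) = ?e"
    using nonneg unfolding lucas_multiple_plus_1_times_phi[OF m] frac_unique_iff by simp
  then show ?thesis
    unfolding just_above_int_def using less by (simp only:)
qed

theorem theorem12:
  fixes n r a b :: nat
  assumes "n \<ge> 2"
    and "r = lucas (2 * n)"
    and "a = fib (2 * n - 1) - 1"
    and "b = lucas (2 * n) - 1"
  shows "(\<forall>k::nat. k \<le> fib (4 * n + 1) - fib (2 * n + 1) - 2 \<longrightarrow> s (r * k + a) = s (r * k + b)) \<and>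
    (\<forall>k::nat. k = fib (4 * n + 1) - fib (2 * n + 1) - 1 \<longrightarrow> s (r * k + a) = 0 \<and> s (r * k + b) = 1)"
proof -
  have diff: "s (r * k + b) - s (r * k + a) =
      of_bool (just_above_int n ((k + 1) * r + 1)) - of_bool (just_above_int n ((k + 1) * r))" for k
    using s_lucas_progression_diff[of n k] assms by simp
  have not_above: "\<not> just_above_int n ((k + 1) * r + i)"
    if "i \<le> 1" "k + 1 + i * fib (2 * n + 1) < fib (4 * n + 1)" for k i
    using fib_le_if_just_above_int[of "k + 1" i n] that \<open>r = _\<close> by auto
  have fib_le: "fib (2 * n + 1) + 2 \<le> fib (4 * n + 1)"
    using \<open>n \<ge> 2\<close> by (rule fib_diff_ge_2)
  have "s (r * k + a) = s (r * k + b)" if "k \<le> fib (4 * n + 1) - fib (2 * n + 1) - 2" for k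
    using diff[of k] not_above[of 0 k] not_above[of 1 k] that fib_le by simp
  moreover have "s (r * k + a) = 0 \<and> s (r * k + b) = 1"
    if "k = fib (4 * n + 1) - fib (2 * n + 1) - 1" for k
  proof -
    have "k + 1 + fib (2 * n + 1) = fib (4 * n + 1)"
      using that fib_le by simp
    then have "s (r * k + b) - s (r * k + a) = 1"
      using diff[of k] not_above[of 0 k] just_above_int_lucas_multiple_plus_1[of n "k + 1"]
        fib_neq_0_nat[of "2 * n + 1"] assms by simp
    then show ?thesis
      using s_nonneg[of "r * k + a"] s_le_1[of "r * k + b"] by linarith
  qed
  ultimately show ?thesis
    by blast
qed

end
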